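(* The feasibility problem $$\text{find } y\in A\cap B,\qquad A:=M(\chi),\quad B:=\{y\in\mathbb{C}^N : |y|^2=r\},$$ with the amplitude constraint $\chi=\{x\in\mathbb{C}^n : |x|=a\}$ can equivalently be reformulated as: $$\text{find } \mathbf{y}\in\mathbf{A}\cap\mathbf{B},$$ where $\mathbf{A}:=\mathbf{M}(\mathbb{C}^n)$, $\mathbf{B}:=\{\mathbf{y}\in\mathbb{C}^{N+n} : |\mathbf{y}|^2=\mathbf{r}\}\subset\mathbb{C}^{N+n}$ with $$\mathbf{M}:=\frac{1}{\sqrt{m+1}}\begin{pmatrix}\sqrt m\,M\\ I_n\end{pmatrix}\in\mathbb{C}^{(N+n)\times n}\quad\text{and}\quad \mathbf{r}:=\frac{1}{m+1}\begin{pmatrix} m\,r\\ a^2\end{pmatrix}\in\mathbb{R}_+^{N+n}.$$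
   Context: $m\ge 2$ is the number of data images, $n$ is the number of pixels of one image, and $N=mn$. The propagation matrix is $$M=\frac{1}{\sqrt m}\begin{pmatrix}FD_1\\ FD_2\\ \vdots\\ FD_m\end{pmatrix}\in\mathbb{C}^{N\times n},$$ where $F\in\mathbb{C}^{n\times n}$ is the unitary matrix representing the discrete Fourier transform and $D_1,\dots,D_m\in\mathbb{C}^{n\times n}$ are unitary matrices representing the phase diversities; thus $M^*M=I_n$, where $I_n$ is the identity matrix of size $n$. The vector $r\in\mathbb{R}_+^N$ is the measured data (image intensities), assumed to satisfy $\min_{1\le i\le N} r_i>0$. The vector $a\in\mathbb{R}_+^n$ is the known amplitude of the complex signal. Absolute values and squares of vectors are taken entrywise. *)

theory Defs
  imports "HOL-Analysis.Analysis"
begin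

definition adjoint_matrix :: "complex ^ 'n ^ 'k \<Rightarrow> complex ^ 'k ^ 'n" where
  "adjoint_matrix A = (\<chi> i j. cnj (A $ j $ i))"

definition unitary_matrix :: "complex ^ 'n ^ 'n \<Rightarrow> bool" where
  "unitary_matrix U \<longleftrightarrow>
     adjoint_matrix U ** U = mat 1 \<and> U ** adjoint_matrix U = mat 1"

text \<open>
  The unitarily normalised discrete Fourier transform of an \<open>n1 \<times> n2\<close> image, written as a
  matrix on vectorised images. The index type carries no canonical order, so \<open>p\<close> and \<open>q\<close>
  record how pixels (columns) and frequencies (rows) are numbered; the one-dimensional transform
  is the case \<open>n1 = 1\<close>. As \<open>q\<close> is independent of \<open>p\<close>, shifted frequency orderings and the
  opposite sign in the exponent are covered as well.
\<close>

definition is_dft_matrix :: "complex ^ 'n ^ 'n \<Rightarrow> bool" where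
  "is_dft_matrix F \<longleftrightarrow>
     (\<exists>(n1::nat) (n2::nat) (p :: 'n \<Rightarrow> nat \<times> nat) (q :: 'n \<Rightarrow> nat \<times> nat).
        bij_betw p UNIV ({..<n1} \<times> {..<n2}) \<and>
        bij_betw q UNIV ({..<n1} \<times> {..<n2}) \<and>
        F = (\<chi> k j. complex_of_real (1 / sqrt (real CARD('n))) *
               cis (- 2 * pi * (real (fst (q k) * fst (p j)) / real n1 +
                                real (snd (q k) * snd (p j)) / real n2))))"

text \<open>
  Vertical concatenation. At element type \<open>'a ^ 'n\<close> this stacks the rows of two matrices.
\<close>

definition stack :: "'a ^ 'i \<Rightarrow> 'a ^ 'j \<Rightarrow> 'a ^ ('i + 'j)" where
  "stack u v = (\<chi> s. case s of Inl i \<Rightarrow> u $ i | Inr j \<Rightarrow> v $ j)"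

definition abs_vec :: "complex ^ 'i \<Rightarrow> real ^ 'i" where
  "abs_vec y = (\<chi> i. cmod (y $ i))"

definition square_vec :: "real ^ 'i \<Rightarrow> real ^ 'i" where
  "square_vec v = (\<chi> i. (v $ i)\<^sup>2)"

text \<open>
  The number of images is \<open>CARD('m)\<close>, the number of pixels is \<open>CARD('n)\<close>, and the index type
  \<open>'m \<times> 'n\<close> has \<open>CARD('m) * CARD('n)\<close> elements: the row \<open>(d, k)\<close> of the propagation matrix is
  row \<open>k\<close> of its \<open>d\<close>-th block.
\<close>

definition propagation_matrix ::
    "complex ^ 'n ^ 'n \<Rightarrow> ('m::finite \<Rightarrow> complex ^ 'n ^ 'n) \<Rightarrow> complex ^ 'n ^ ('m \<times> 'n)" where
  "propagation_matrix F D =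
     (1 / sqrt (real CARD('m))) *\<^sub>R (\<chi> i. (F ** D (fst i)) $ snd i)"

definition extended_matrix ::
    "complex ^ 'n ^ ('m::finite \<times> 'n) \<Rightarrow> complex ^ 'n ^ ('m \<times> 'n + 'n)" where
  "extended_matrix M =
     (1 / sqrt (real CARD('m) + 1)) *\<^sub>R stack (sqrt (real CARD('m)) *\<^sub>R M) (mat 1)"

definition extended_data ::
    "real ^ ('m::finite \<times> 'n) \<Rightarrow> real ^ 'n \<Rightarrow> real ^ ('m \<times> 'n + 'n)" where
  "extended_data r a =
     (1 / (real CARD('m) + 1)) *\<^sub>R stack (real CARD('m) *\<^sub>R r) (square_vec a)"

definition amplitude_set :: "real ^ 'i \<Rightarrow> (complex ^ 'i) set" where
  "amplitude_set a = {x. abs_vec x = a}"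

definition intensity_set :: "real ^ 'i \<Rightarrow> (complex ^ 'i) set" where
  "intensity_set r = {y. square_vec (abs_vec y) = r}"

end

theory Submission
  imports Defs
begin

text \<open>
  Both problems have the same set of solutions when they are read as problems for the object
  \<open>x\<close> instead of its image: the set \<open>S\<close> of all \<open>x\<close> with \<open>|x| = a\<close> and \<open>|M x|\<^sup>2 = r\<close>. For the
  extended problem this is immediate, because the rows of the identity block of the extended
  matrix turn the amplitude constraint into one more block of intensity measurements; the two
  normalising factors \<open>m / (m + 1)\<close> and \<open>1 / (m + 1)\<close> in the data are the squares of the
  factors in the matrix, and \<open>|x|\<^sup>2 = a\<^sup>2\<close> means \<open>|x| = a\<close> since \<open>a \<ge> 0\<close>
  (\<open>extended_matrix_mult_in_intensity_set_iff\<close>).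

  For the original problem, \<open>M x \<in> M(\<chi>)\<close> must give back \<open>x \<in> \<chi>\<close>, so \<open>M\<close> has to be injective.
  This follows from \<open>M\<^sup>* M = I\<close> (\<open>adjoint_propagation_matrix_mult\<close>): the blocks \<open>F D\<^sub>d\<close> are
  isometries, and \<open>M\<^sup>* M\<close> is the average of the matrices \<open>(F D\<^sub>d)\<^sup>* (F D\<^sub>d) = I\<close>. The isometry
  property of \<open>F\<close> is the orthogonality of the characters of the cyclic groups of orders
  \<open>n1\<close> and \<open>n2\<close>.

  Hence \<open>M\<close> and the extended matrix are injective and map \<open>S\<close> onto the two feasible sets. As
  \<open>M\<^sup>*\<close> inverts \<open>M\<close> on its range, sending \<open>y\<close> to the image of \<open>M\<^sup>* y\<close> under the extended matrix
  is a bijection from the first feasible set to the second.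
\<close>

text \<open>
  The summands are the powers of \<open>w = cis (2 \<pi> (u - v) / n)\<close>, an \<open>n\<close>-th root of unity. The
  bounds on \<open>u\<close> and \<open>v\<close> ensure that \<open>w \<noteq> 1\<close> unless \<open>u = v\<close>, and then the geometric sum vanishes.
\<close>

lemma sum_cis_orthogonality:
  assumes "u < n" "v < n"
  shows "(\<Sum>k<n. cis (2 * pi * (real k * (real u - real v) / real n)))
           = (if u = v then of_nat n else 0)"
proof (cases "u = v")
  case True
  then show ?thesis by simp
next
  case False
  define w where "w = cis (2 * pi * (real u - real v) / real n)"
  have n: "n > 0" using assms by simp
  have "cis (2 * pi * real u / real n) \<noteq> cis (2 * pi * real v / real n)"
    using Complex.bij_betw_roots_unity[OF n] assms False
    unfolding bij_betw_def inj_on_def by auto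
  moreover have "cis (2 * pi * real u / real n) = w * cis (2 * pi * real v / real n)"
    unfolding w_def cis_mult
    by (rule arg_cong[where f = cis]) (simp add: algebra_simps diff_divide_distrib)
  ultimately have w1: "w \<noteq> 1" by auto
  have "w ^ n = cis (2 * pi * (real u - real v))"
    using n unfolding w_def Complex.DeMoivre by (intro arg_cong[where f = cis]) simp
  also have "\<dots> = 1" by (rule cis_multiple_2pi) simp
  finally have wn: "w ^ n = 1" .
  have "(\<Sum>k<n. cis (2 * pi * (real k * (real u - real v) / real n))) = (\<Sum>k<n. w ^ k)"
    by (simp add: w_def Complex.DeMoivre algebra_simps)
  also have "\<dots> = 0" using geometric_sum[OF w1, of n] wn by simp
  finally show ?thesis using False by simp
qed

text \<open>
  After renumbering the frequencies by \<open>q\<close>, the sum over all frequencies factors into one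
  character sum for each of the two image axes.
\<close>

lemma adjoint_dft_matrix_mult:
  fixes F :: "complex ^ 'n ^ 'n"
  assumes "is_dft_matrix F"
  shows "adjoint_matrix F ** F = mat 1"
proof -
  obtain n1 n2 :: nat and p q :: "'n \<Rightarrow> nat \<times> nat"
    where p: "bij_betw p UNIV ({..<n1} \<times> {..<n2})"
      and q: "bij_betw q UNIV ({..<n1} \<times> {..<n2})"
      and F: "F = (\<chi> k j. complex_of_real (1 / sqrt (real CARD('n))) *
               cis (- 2 * pi * (real (fst (q k) * fst (p j)) / real n1 +
                                real (snd (q k) * snd (p j)) / real n2)))"
    using assms unfolding is_dft_matrix_def by blast
  have card: "CARD('n) = n1 * n2"
    using bij_betw_same_card[OF p] by simp
  have p_less: "fst (p j) < n1" "snd (p j) < n2" for j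
    using bij_betwE[OF p] by (auto simp: mem_Times_iff)
  have p_eq: "fst (p j) = fst (p l) \<and> snd (p j) = snd (p l) \<longleftrightarrow> j = l" for j l
    using bij_betw_imp_inj_on[OF p] by (auto simp: inj_on_def prod_eq_iff)
  have "(adjoint_matrix F ** F) $ j $ l = mat 1 $ j $ l" for j l
  proof -
    define e1 where
      "e1 b = cis (2 * pi * (real b * (real (fst (p j)) - real (fst (p l))) / real n1))" for b
    define e2 where
      "e2 c = cis (2 * pi * (real c * (real (snd (p j)) - real (snd (p l))) / real n2))" for c
    have entry: "cnj (F $ k $ j) * F $ k $ l
        = of_real (1 / real CARD('n)) * (e1 (fst (q k)) * e2 (snd (q k)))" for k
    proof -
      have "cnj (F $ k $ j) * F $ k $ l
          = of_real (1 / sqrt (real CARD('n))) * of_real (1 / sqrt (real CARD('n))) *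
            (cis (2 * pi * (real (fst (q k) * fst (p j)) / real n1 +
                            real (snd (q k) * snd (p j)) / real n2)) *
             cis (- 2 * pi * (real (fst (q k) * fst (p l)) / real n1 +
                              real (snd (q k) * snd (p l)) / real n2)))"
        by (simp add: F cis_cnj)
      also have "of_real (1 / sqrt (real CARD('n))) * of_real (1 / sqrt (real CARD('n)))
          = complex_of_real (1 / real CARD('n))"
        by (simp flip: of_real_mult)
      also have "cis (2 * pi * (real (fst (q k) * fst (p j)) / real n1 +
                                real (snd (q k) * snd (p j)) / real n2)) *
             cis (- 2 * pi * (real (fst (q k) * fst (p l)) / real n1 +
                              real (snd (q k) * snd (p l)) / real n2))
          = e1 (fst (q k)) * e2 (snd (q k))"
        unfolding e1_def e2_def cis_mult
        by (rule arg_cong[where f = cis]) (simp add: algebra_simps diff_divide_distrib)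
      finally show ?thesis .
    qed
    have "(adjoint_matrix F ** F) $ j $ l
        = of_real (1 / real CARD('n)) * (\<Sum>k\<in>UNIV. e1 (fst (q k)) * e2 (snd (q k)))"
      by (simp add: matrix_matrix_mult_def adjoint_matrix_def entry sum_distrib_left)
    also have "(\<Sum>k\<in>UNIV. e1 (fst (q k)) * e2 (snd (q k)))
        = (\<Sum>s\<in>{..<n1} \<times> {..<n2}. e1 (fst s) * e2 (snd s))"
      by (rule sum.reindex_bij_betw[OF q])
    also have "\<dots> = (\<Sum>b<n1. e1 b) * (\<Sum>c<n2. e2 c)"
      by (simp add: sum_product sum.cartesian_product case_prod_beta)
    also have "\<dots> = (if j = l then of_nat CARD('n) else 0)"
      unfolding e1_def e2_def sum_cis_orthogonality[OF p_less(1) p_less(1)]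
        sum_cis_orthogonality[OF p_less(2) p_less(2)]
      using p_eq[of j l] by (auto simp: card)
    finally show ?thesis by (simp add: mat_def)
  qed
  then show ?thesis by (simp add: vec_eq_iff)
qed

lemma adjoint_matrix_mult:
  "adjoint_matrix (A ** B) = adjoint_matrix B ** adjoint_matrix A"
  by (simp add: adjoint_matrix_def matrix_matrix_mult_def vec_eq_iff mult.commute)

lemma isometry_mult:
  assumes "adjoint_matrix A ** A = mat 1" and "adjoint_matrix B ** B = mat 1"
  shows "adjoint_matrix (A ** B) ** (A ** B) = mat 1"
  by (metis adjoint_matrix_mult assms matrix_mul_assoc matrix_mul_rid)

text \<open>
  Summing over the row index \<open>(d, k)\<close> first over \<open>k\<close> gives the Gram matrix of the \<open>d\<close>-th block,
  which is the identity; the factor \<open>1 / m\<close> turns the sum over \<open>d\<close> into an average.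
\<close>

lemma adjoint_propagation_matrix_mult:
  fixes F :: "complex ^ 'n ^ 'n" and D :: "'m::finite \<Rightarrow> complex ^ 'n ^ 'n"
  assumes "is_dft_matrix F" and "\<And>d. unitary_matrix (D d)"
  shows "adjoint_matrix (propagation_matrix F D) ** propagation_matrix F D = mat 1"
proof -
  have block: "adjoint_matrix (F ** D d) ** (F ** D d) = mat 1" for d
    using assms by (simp add: isometry_mult adjoint_dft_matrix_mult unitary_matrix_def)
  have "(adjoint_matrix (propagation_matrix F D) ** propagation_matrix F D) $ j $ l
      = mat 1 $ j $ l" for j l
  proof -
    have "(adjoint_matrix (propagation_matrix F D) ** propagation_matrix F D) $ j $ l
        = (\<Sum>i\<in>UNIV. of_real (1 / real CARD('m)) *
            (cnj ((F ** D (fst i)) $ snd i $ j) * (F ** D (fst i)) $ snd i $ l))"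
      unfolding matrix_matrix_mult_def[of "adjoint_matrix (propagation_matrix F D)"]
      by (simp add: adjoint_matrix_def propagation_matrix_def scaleR_conv_of_real[where 'a = complex]
            field_simps flip: of_real_mult)
    also have "\<dots> = of_real (1 / real CARD('m)) * (\<Sum>d\<in>UNIV. \<Sum>k\<in>UNIV.
            cnj ((F ** D d) $ k $ j) * (F ** D d) $ k $ l)"
      by (simp add: sum_distrib_left sum.cartesian_product case_prod_beta)
    also have "\<dots> = of_real (1 / real CARD('m)) *
        (\<Sum>d\<in>(UNIV :: 'm set). (adjoint_matrix (F ** D d) ** (F ** D d)) $ j $ l)"
      unfolding matrix_matrix_mult_def[of "adjoint_matrix (F ** D _)"]
      by (simp add: adjoint_matrix_def)
    also have "\<dots> = mat 1 $ j $ l" by (simp add: block)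
    finally show ?thesis .
  qed
  then show ?thesis by (simp add: vec_eq_iff)
qed

lemma extended_matrix_mult_Inl:
  fixes M :: "complex ^ 'n ^ ('m::finite \<times> 'n)"
  shows "(extended_matrix M *v x) $ Inl i
    = of_real (sqrt (real CARD('m)) / sqrt (real CARD('m) + 1)) * (M *v x) $ i"
  by (simp add: extended_matrix_def stack_def matrix_vector_mult_def sum_distrib_left
      scaleR_conv_of_real[where 'a = complex] field_simps)

lemma extended_matrix_mult_Inr:
  fixes M :: "complex ^ 'n ^ ('m::finite \<times> 'n)"
  shows "(extended_matrix M *v x) $ Inr j = of_real (1 / sqrt (real CARD('m) + 1)) * x $ j"
proof -
  have "(extended_matrix M *v x) $ Inr j
      = of_real (1 / sqrt (real CARD('m) + 1)) * (mat 1 *v x) $ j"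
    unfolding matrix_vector_mult_def sum_distrib_left
    by (simp add: extended_matrix_def stack_def sum_distrib_left scaleR_conv_of_real[where 'a = complex] mult.assoc)
  then show ?thesis by simp
qed

text \<open>
  Injectivity holds for every \<open>M\<close>: the identity block keeps a scaled copy of \<open>x\<close>.
\<close>

lemma inj_extended_matrix:
  fixes M :: "complex ^ 'n ^ ('m::finite \<times> 'n)"
  shows "inj (\<lambda>x. extended_matrix M *v x)"
proof (rule injI)
  fix x y assume eq: "extended_matrix M *v x = extended_matrix M *v y"
  have "sqrt (real CARD('m) + 1) \<noteq> 0"
    by (simp add: add_nonneg_eq_0_iff)
  moreover have "(extended_matrix M *v x) $ Inr j = (extended_matrix M *v y) $ Inr j" for j
    by (simp add: eq)
  ultimately have "x $ j = y $ j" for j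
    unfolding extended_matrix_mult_Inr by (simp del: of_real_divide)
  then show "x = y" by (simp add: vec_eq_iff)
qed

text \<open>
  The condition splits along the two blocks. In each block the data carry the square of the
  positive factor that the matrix applies, so the factor cancels; in the second block
  nonnegativity of \<open>a\<close> allows taking square roots.
\<close>

lemma extended_matrix_mult_in_intensity_set_iff:
  fixes M :: "complex ^ 'n ^ ('m::finite \<times> 'n)"
  assumes a: "\<And>j. a $ j \<ge> 0"
  shows "extended_matrix M *v x \<in> intensity_set (extended_data r a)
     \<longleftrightarrow> M *v x \<in> intensity_set r \<and> x \<in> amplitude_set a"
proof -
  define m where "m = real CARD('m)"
  have m: "m > 0" by (simp add: m_def)
  have Inl: "(cmod ((extended_matrix M *v x) $ Inl i))\<^sup>2 = extended_data r a $ Inl i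
      \<longleftrightarrow> (cmod ((M *v x) $ i))\<^sup>2 = r $ i" for i
  proof -
    have "(cmod ((extended_matrix M *v x) $ Inl i))\<^sup>2 = m / (m + 1) * (cmod ((M *v x) $ i))\<^sup>2"
      unfolding extended_matrix_mult_Inl m_def[symmetric] norm_mult norm_of_real
      using m by (simp add: power_mult_distrib power_divide)
    moreover have "extended_data r a $ Inl i = m / (m + 1) * r $ i"
      by (simp add: extended_data_def stack_def m_def)
    moreover have "m / (m + 1) \<noteq> 0" using m by simp
    ultimately show ?thesis by (metis mult_left_cancel)
  qed
  have Inr: "(cmod ((extended_matrix M *v x) $ Inr j))\<^sup>2 = extended_data r a $ Inr j
      \<longleftrightarrow> cmod (x $ j) = a $ j" for j
  proof -
    have "(cmod ((extended_matrix M *v x) $ Inr j))\<^sup>2 = 1 / (m + 1) * (cmod (x $ j))\<^sup>2"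
      unfolding extended_matrix_mult_Inr m_def[symmetric] norm_mult norm_of_real
      using m by (simp add: power_mult_distrib power_divide)
    moreover have "extended_data r a $ Inr j = 1 / (m + 1) * (a $ j)\<^sup>2"
      by (simp add: extended_data_def stack_def m_def square_vec_def)
    moreover have "1 / (m + 1) \<noteq> 0" using m by simp
    ultimately have "(cmod ((extended_matrix M *v x) $ Inr j))\<^sup>2 = extended_data r a $ Inr j
        \<longleftrightarrow> (cmod (x $ j))\<^sup>2 = (a $ j)\<^sup>2" by (metis mult_left_cancel)
    also have "\<dots> \<longleftrightarrow> cmod (x $ j) = a $ j"
      using a by (intro power2_eq_iff_nonneg) auto
    finally show ?thesis .
  qed
  have split: "(\<forall>s. P s) \<longleftrightarrow> (\<forall>i. P (Inl i)) \<and> (\<forall>j. P (Inr j))"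
    for P :: "('m \<times> 'n) + 'n \<Rightarrow> bool"
    by (metis sumE)
  show ?thesis
    by (simp add: intensity_set_def amplitude_set_def square_vec_def abs_vec_def vec_eq_iff
        split[of "\<lambda>s. (cmod ((extended_matrix M *v x) $ s))\<^sup>2 = extended_data r a $ s"] Inl Inr)
qed

lemma extended_data_nonneg:
  assumes "\<And>i. r $ i \<ge> 0"
  shows "extended_data r a $ s \<ge> 0"
  using assms by (cases s) (simp_all add: extended_data_def stack_def square_vec_def)

theorem proposition2:
  fixes F :: "complex ^ 'n ^ 'n"
    and D :: "'m::finite \<Rightarrow> complex ^ 'n ^ 'n"
    and r :: "real ^ ('m \<times> 'n)"
    and a :: "real ^ 'n"
    and M :: "complex ^ 'n ^ ('m \<times> 'n)"
    and A B :: "(complex ^ ('m \<times> 'n)) set"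
    and MM :: "complex ^ 'n ^ ('m \<times> 'n + 'n)"
    and rr :: "real ^ ('m \<times> 'n + 'n)"
    and AA BB :: "(complex ^ ('m \<times> 'n + 'n)) set"
  assumes "CARD('m) \<ge> 2"
    and "is_dft_matrix F"
    and "\<And>d. unitary_matrix (D d)"
    and "\<And>i. r $ i > 0"
    and "\<And>j. a $ j \<ge> 0"
    and "M = propagation_matrix F D"
    and "A = (\<lambda>x. M *v x) ` amplitude_set a"
    and "B = intensity_set r"
    and "MM = extended_matrix M"
    and "rr = extended_data r a"
    and "AA = range (\<lambda>x. MM *v x)"
    and "BB = intensity_set rr"
  shows "(\<forall>s. rr $ s \<ge> 0) \<and>
    ((\<exists>y. y \<in> A \<inter> B) \<longleftrightarrow> (\<exists>z. z \<in> AA \<inter> BB)) \<and>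
    (\<forall>x. M *v x \<in> A \<inter> B \<longleftrightarrow> MM *v x \<in> AA \<inter> BB) \<and>
    bij_betw (\<lambda>y. MM *v (adjoint_matrix M *v y)) (A \<inter> B) (AA \<inter> BB)"
proof -
  define S where "S = {x. x \<in> amplitude_set a \<and> M *v x \<in> B}"
  have "adjoint_matrix M ** M = mat 1"
    using assms by (simp add: adjoint_propagation_matrix_mult)
  then have left_inverse: "adjoint_matrix M *v (M *v x) = x" for x
    by (simp add: matrix_vector_mul_assoc)
  then have M_inject: "M *v x = M *v x' \<longleftrightarrow> x = x'" for x x' by metis
  have MM_inject: "inj (\<lambda>x. MM *v x)" using assms inj_extended_matrix by simp
  have in_AB: "M *v x \<in> A \<inter> B \<longleftrightarrow> x \<in> S" for x
    unfolding \<open>A = _\<close> by (auto simp: S_def M_inject)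
  have in_AABB: "MM *v x \<in> AA \<inter> BB \<longleftrightarrow> x \<in> S" for x
    using assms extended_matrix_mult_in_intensity_set_iff[of a M x r] by (auto simp: S_def)
  have AB: "A \<inter> B = (\<lambda>x. M *v x) ` S"
    using assms by (auto simp: S_def)
  have AABB: "AA \<inter> BB = (\<lambda>x. MM *v x) ` S"
    using assms in_AABB by auto
  have "bij_betw (\<lambda>y. adjoint_matrix M *v y) (A \<inter> B) S"
    by (rule bij_betw_byWitness[where f' = "\<lambda>x. M *v x"]) (auto simp: AB left_inverse)
  moreover have "bij_betw (\<lambda>x. MM *v x) S (AA \<inter> BB)"
    unfolding AABB using MM_inject by (simp add: bij_betw_def inj_on_def)
  ultimately have "bij_betw (\<lambda>y. MM *v (adjoint_matrix M *v y)) (A \<inter> B) (AA \<inter> BB)"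
    using bij_betw_trans by (fastforce simp: comp_def)
  moreover have "\<forall>s. rr $ s \<ge> 0"
    using assms by (simp add: extended_data_nonneg less_imp_le)
  moreover have "(\<exists>y. y \<in> A \<inter> B) \<longleftrightarrow> (\<exists>z. z \<in> AA \<inter> BB)"
    unfolding AB AABB by auto
  ultimately show ?thesis using in_AB in_AABB by blast
qed

end
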